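(* For every integer $n\ge 0$, the number of bispecial Sturmian words of length $n$ over the alphabet $\{a,b\}$ is exactly $2(n+1)-\phi(n+2)$, where $\phi$ is the Euler totient function.
   Context: Words are finite and over the alphabet $\Sigma=\{a,b\}$; $|u|_a$ is the number of occurrences of the letter $a$ in $u$; a factor is a contiguous subword. A word $w\in\Sigma^*$ is Sturmian if it is balanced: for any two factors $u,v$ of $w$ of the same length, $\big||u|_a-|v|_a\big|\le 1$. Let $St$ be the set of (finite) Sturmian words. A word $w\in St$ is left special if $aw,bw\in St$, right special if $wa,wb\in St$, and bispecial if it is both left and right special. $\phi(m)$ is the number of positive integers smaller than or equal to $m$ and coprime with $m$. *)

theory Defs
  imports "HOL-Library.Sublist" "HOL-Number_Theory.Totient"
begin

datatype letter = La | Lb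

type_synonym word = "letter list"

(* Factors are contiguous subwords, i.e. sublist; |u|_a is count_list u La. *)
definition sturmian :: "word \<Rightarrow> bool" where
  "sturmian w \<longleftrightarrow>
     (\<forall>u v. sublist u w \<and> sublist v w \<and> length u = length v \<longrightarrow>
        \<bar>int (count_list u La) - int (count_list v La)\<bar> \<le> 1)"

definition St :: "word set" where
  "St = {w. sturmian w}"

definition left_special :: "word \<Rightarrow> bool" where
  "left_special w \<longleftrightarrow> w \<in> St \<and> La # w \<in> St \<and> Lb # w \<in> St"

definition right_special :: "word \<Rightarrow> bool" where
  "right_special w \<longleftrightarrow> w \<in> St \<and> w @ [La] \<in> St \<and> w @ [Lb] \<in> St"

definition bispecial :: "word \<Rightarrow> bool" where
  "bispecial w \<longleftrightarrow> left_special w \<and> right_special w"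

end

theory Submission
  imports Defs
begin

text \<open>
  Let \<open>H i\<close> be the number of letters \<open>La\<close> in the prefix of length \<open>i\<close> of a word \<open>w\<close> of length
  \<open>n\<close>, put \<open>N = n + 2\<close>, \<open>q = H n + 1\<close> and \<open>G x = H (x - 1)\<close> for \<open>0 < x < N\<close>. Being bispecial says
  that \<open>G (x + y) - G x - G y\<close> and \<open>G (x + y - N) + q - G x - G y\<close> lie in \<open>{0, 1}\<close> whenever the
  arguments are strictly between \<open>0\<close> and \<open>N\<close>. The defect \<open>G x + G (N - x) - H n\<close> vanishes at
  \<open>x = 1\<close> and two of its values differ by at most one, so it is everywhere in \<open>{0, 1}\<close> or
  everywhere in \<open>{-1, 0}\<close>. In the first case \<open>G\<close> with \<open>G 0 = 0\<close>, and in the second case \<open>G + 1\<close>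
  with value \<open>0\<close> at \<open>0\<close>, extends \<open>N\<close>-periodically up to the slope \<open>q / N\<close> to a function that is
  additive up to a one-sided error of one; hence it is the floor, respectively the ceiling, of
  \<open>q * x / N\<close>. So the bispecial words of length \<open>n\<close> are the interiors of the lower and of the upper
  Christoffel words of length \<open>N\<close>, \<open>n + 1\<close> of each kind, and a lower interior is an upper one
  exactly if \<open>q\<close> is coprime to \<open>N\<close>.
\<close>

section \<open>Functions that are additive up to a one-sided error\<close>

text \<open>Running through the multiples \<open>k * x\<close> modulo \<open>N\<close>, each new
  addition of \<open>x\<close> costs an error of 0 or 1. After \<open>N\<close> terms, that is
  \<open>N - 1\<close> additions, the total error is below \<open>N\<close>, which pins down the
  quotient. The sign of \<open>q\<close> is free, so ceilings can be treated by negation.\<close>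

lemma floor_of_quasi_additive:
  fixes f :: "nat \<Rightarrow> int" and q :: int
  assumes f0: "f 0 = 0"
    and low: "\<And>x y. x + y < N \<Longrightarrow> f (x + y) - f x - f y \<in> {0, 1}"
    and high: "\<And>x y. x < N \<Longrightarrow> y < N \<Longrightarrow> N \<le> x + y \<Longrightarrow> f (x + y - N) + q - f x - f y \<in> {0, 1}"
    and x: "x < N"
  shows "f x = q * int x div int N"
proof -
  have divmod: "(m * N + s) mod N = s" "(m * N + s) div N = m" if "s < N" for m s
    using that by simp_all
  \<comment> \<open>The value at \<open>m * N + r\<close> of the extension of \<open>f\<close> is
    \<open>f r + q * m\<close>. The case \<open>k = 1\<close> has no error, hence the bound
    \<open>k - 1\<close>.\<close>
  have multiple: "int k * f x \<le> f (k * x mod N) + q * int (k * x div N) \<and>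
      f (k * x mod N) + q * int (k * x div N) \<le> int k * f x + int k - 1" if "k \<ge> 1" for k
    using that
  proof (induction k rule: nat_induct_at_least)
    case base
    then show ?case using x by simp
  next
    case (Suc k)
    define r where "r = k * x mod N"
    define m where "m = k * x div N"
    have r: "r < N" using x by (simp add: r_def)
    have kx: "k * x = m * N + r" by (simp add: r_def m_def)
    have IH: "int k * f x \<le> f r + q * int m" "f r + q * int m \<le> int k * f x + int k - 1"
      using Suc.IH by (simp_all add: r_def m_def)
    show ?case
    proof (cases "r + x < N")
      case True
      have "Suc k * x = m * N + (r + x)" using kx by simp
      then have "Suc k * x mod N = r + x" "Suc k * x div N = m"
        using divmod[OF True] by metis+
      moreover have "f (r + x) - f r - f x \<in> {0, 1}" using low True by blast
      ultimately show ?thesis using IH by (auto simp: algebra_simps)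
    next
      case False
      have "Suc k * x = Suc m * N + (r + x - N)" using kx False by simp
      moreover have "r + x - N < N" using r x by simp
      ultimately have "Suc k * x mod N = r + x - N" "Suc k * x div N = Suc m"
        using divmod by metis+
      moreover have "f (r + x - N) + q - f r - f x \<in> {0, 1}" using high False r x by auto
      ultimately show ?thesis using IH by (auto simp: algebra_simps)
    qed
  qed
  have N: "int N > 0" using x by simp
  \<comment> \<open>For \<open>k = N\<close> the residue is 0 and the quotient is
    \<open>x\<close>.\<close>
  have "int N * f x \<le> q * int x" "q * int x \<le> int N * f x + int N - 1"
    using multiple[of N] x f0 by simp_all
  then show ?thesis
    by (intro int_div_pos_eq[where r = "q * int x - int N * f x", symmetric]) simp_all
qed

section \<open>Heights of words\<close>

definition height :: "word \<Rightarrow> nat \<Rightarrow> int" where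
  "height w i = int (count_list (take i w) La)"

lemma height_0 [simp]: "height w 0 = 0"
  by (simp add: height_def)

lemma height_Cons_Suc [simp]: "height (x # w) (Suc i) = (if x = La then 1 else 0) + height w i"
  by (simp add: height_def)

lemma height_Suc:
  "i < length w \<Longrightarrow> height w (Suc i) = height w i + (if w ! i = La then 1 else 0)"
  by (simp add: height_def take_Suc_conv_app_nth)

lemma count_list_take_drop:
  "int (count_list (take d (drop i w)) La) = height w (i + d) - height w i"
  by (simp add: height_def take_add)

lemma height_rev:
  assumes "i \<le> length w"
  shows "height (rev w) i = height w (length w) - height w (length w - i)"
proof -
  have "count_list w La = count_list (take (length w - i) w) La + count_list (drop (length w - i) w) La"
    by (metis append_take_drop_id count_list_append)
  then show ?thesis by (simp add: height_def take_rev)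
qed

lemma word_eqI_height:
  assumes "length u = length v" "\<And>i. i \<le> length u \<Longrightarrow> height u i = height v i"
  shows "u = v"
proof (rule nth_equalityI)
  fix i assume i: "i < length u"
  have "(u ! i = La) = (v ! i = La)"
    using height_Suc[of i u] height_Suc[of i v] assms i
    by (auto simp: Suc_le_eq split: if_splits)
  then show "u ! i = v ! i" by (metis letter.exhaust)
qed (rule assms(1))

lemma sublist_iff_take_drop:
  "sublist u w \<longleftrightarrow> (\<exists>i d. i + d \<le> length w \<and> u = take d (drop i w))"
proof
  assume "sublist u w"
  then obtain p s where "w = p @ u @ s" by (auto simp: sublist_def)
  then show "\<exists>i d. i + d \<le> length w \<and> u = take d (drop i w)"
    by (intro exI[of _ "length p"] exI[of _ "length u"]) simp
next
  assume "\<exists>i d. i + d \<le> length w \<and> u = take d (drop i w)"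
  then show "sublist u w" by (meson sublist_drop sublist_order.order.trans sublist_take)
qed

lemma sturmian_iff_height:
  "sturmian w \<longleftrightarrow> (\<forall>i j d. i + d \<le> length w \<longrightarrow> j + d \<le> length w \<longrightarrow>
     \<bar>(height w (i + d) - height w i) - (height w (j + d) - height w j)\<bar> \<le> 1)"
  (is "_ \<longleftrightarrow> ?R")
proof
  assume s: "sturmian w"
  show ?R
  proof (intro allI impI)
    fix i j d assume ij: "i + d \<le> length w" "j + d \<le> length w"
    then have "sublist (take d (drop i w)) w" "sublist (take d (drop j w)) w"
      by (auto simp: sublist_iff_take_drop)
    moreover have "length (take d (drop i w)) = length (take d (drop j w))" using ij by simp
    ultimately show "\<bar>(height w (i + d) - height w i) - (height w (j + d) - height w j)\<bar> \<le> 1"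
      using s unfolding sturmian_def count_list_take_drop[symmetric] by blast
  qed
next
  assume R: ?R
  show "sturmian w"
    unfolding sturmian_def
  proof (intro allI impI, elim conjE)
    fix u v assume "sublist u w" "sublist v w" and l: "length u = length v"
    then obtain i d j e where "i + d \<le> length w" "u = take d (drop i w)"
      "j + e \<le> length w" "v = take e (drop j w)"
      unfolding sublist_iff_take_drop by blast
    then show "\<bar>int (count_list u La) - int (count_list v La)\<bar> \<le> 1"
      using R l by (simp add: count_list_take_drop)
  qed
qed

lemma sturmian_rev [simp]: "sturmian (rev w) = sturmian w"
proof -
  have "sturmian (rev w)" if s: "sturmian w" for w
    unfolding sturmian_def
  proof (intro allI impI, elim conjE)
    fix u v assume "sublist u (rev w)" "sublist v (rev w)" "length u = length v"
    then have "sublist (rev u) w" "sublist (rev v) w" "length (rev u) = length (rev v)"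
      by (simp_all add: sublist_rev_right)
    then show "\<bar>int (count_list u La) - int (count_list v La)\<bar> \<le> 1"
      using s unfolding sturmian_def by (metis count_list_rev)
  qed
  from this[of w] this[of "rev w"] show ?thesis by auto
qed

section \<open>Special words in terms of heights\<close>

text \<open>The prefixes of length \<open>Suc k\<close> of \<open>La # w\<close> and
  \<open>Lb # w\<close> contain \<open>height w k + 1\<close> and \<open>height w k\<close> letters
  \<open>La\<close>. A factor of \<open>w\<close> of that length is within one of both only if its
  count is one of these two numbers; conversely, any two such counts differ by at most one.\<close>

lemma left_special_iff_height:
  "left_special w \<longleftrightarrow> (\<forall>i k. i + Suc k \<le> length w \<longrightarrow>
     height w (i + Suc k) - height w i - height w k \<in> {0, 1})"
  (is "_ \<longleftrightarrow> ?R")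
proof
  assume l: "left_special w"
  show ?R
  proof (intro allI impI)
    fix i k assume ik: "i + Suc k \<le> length w"
    have "\<bar>(height (x # w) (0 + Suc k) - height (x # w) 0)
        - (height (x # w) (Suc i + Suc k) - height (x # w) (Suc i))\<bar> \<le> 1" for x
    proof -
      have "sturmian (x # w)"
        using l by (cases x) (auto simp: left_special_def St_def)
      moreover have "0 + Suc k \<le> length (x # w)" "Suc i + Suc k \<le> length (x # w)"
        using ik by simp_all
      ultimately show ?thesis unfolding sturmian_iff_height by blast
    qed
    from this[of La] this[of Lb]
    show "height w (i + Suc k) - height w i - height w k \<in> {0, 1}" by auto
  qed
next
  assume R: ?R
  have R': "height w (i + Suc k) = height w i + height w k \<or>
    height w (i + Suc k) = height w i + height w k + 1" if "i + Suc k \<le> length w" for i k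
    using R[rule_format, OF that] by auto
  have w: "sturmian w"
    unfolding sturmian_iff_height
  proof (intro allI impI)
    fix i j d assume "i + d \<le> length w" "j + d \<le> length w"
    then show "\<bar>(height w (i + d) - height w i) - (height w (j + d) - height w j)\<bar> \<le> 1"
      using R'[of i "d - 1"] R'[of j "d - 1"] by (cases d) auto
  qed
  have "sturmian (x # w)" for x
    unfolding sturmian_iff_height
  proof (intro allI impI)
    fix i j d assume ij: "i + d \<le> length (x # w)" "j + d \<le> length (x # w)"
    show "\<bar>(height (x # w) (i + d) - height (x # w) i)
        - (height (x # w) (j + d) - height (x # w) j)\<bar> \<le> 1"
    proof (cases d)
      case 0
      then show ?thesis by simp
    next
      case (Suc k)
      show ?thesis
        using ij Suc R'[of "i - 1" k] R'[of "j - 1" k]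
        by (cases i; cases j) auto
    qed
  qed
  with w show "left_special w" by (simp add: left_special_def St_def)
qed

lemma right_special_iff_rev: "right_special w \<longleftrightarrow> left_special (rev w)"
proof -
  have "sturmian (w @ [x]) = sturmian (x # rev w)" for x
    using sturmian_rev[of "w @ [x]"] by simp
  then show ?thesis by (simp add: right_special_def left_special_def St_def)
qed

text \<open>Reversal sends the factor of length \<open>Suc k\<close> at \<open>i\<close> to the one
  at \<open>n - (i + Suc k)\<close>; for fixed \<open>k\<close> this is an involution of the
  admissible \<open>i\<close>. The count is now compared with that of the suffix of length
  \<open>k\<close>.\<close>

lemma right_special_iff_height:
  assumes n: "length w = n"
  shows "right_special w \<longleftrightarrow> (\<forall>i k. i + Suc k \<le> n \<longrightarrow>
     height w (i + Suc k) - height w i + height w (n - k) - height w n \<in> {0, 1})"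
    (is "_ \<longleftrightarrow> ?R")
proof -
  have eq: "height (rev w) (i + Suc k) - height (rev w) i - height (rev w) k =
      height w ((n - (i + Suc k)) + Suc k) - height w (n - (i + Suc k))
      + height w (n - k) - height w n"
    if "i + Suc k \<le> n" for i k
  proof -
    have "n - (i + Suc k) + Suc k = n - i" using that by simp
    then show ?thesis using that by (simp add: height_rev n)
  qed
  show ?thesis
  proof
    assume "right_special w"
    then have l: "\<forall>i k. i + Suc k \<le> n \<longrightarrow>
        height (rev w) (i + Suc k) - height (rev w) i - height (rev w) k \<in> {0, 1}"
      by (simp add: right_special_iff_rev left_special_iff_height n)
    show ?R
    proof (intro allI impI)
      fix i k assume ik: "i + Suc k \<le> n"
      then have "n - (i + Suc k) + Suc k \<le> n" "n - (n - (i + Suc k) + Suc k) = i" by simp_all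
      with l eq[of "n - (i + Suc k)" k]
      show "height w (i + Suc k) - height w i + height w (n - k) - height w n \<in> {0, 1}"
        by metis
    qed
  next
    assume R: ?R
    have "height (rev w) (i + Suc k) - height (rev w) i - height (rev w) k \<in> {0, 1}"
      if "i + Suc k \<le> n" for i k
    proof -
      have "n - (i + Suc k) + Suc k \<le> n" using that by simp
      with R show ?thesis unfolding eq[OF that] by blast
    qed
    then show "right_special w"
      by (simp add: right_special_iff_rev left_special_iff_height n)
  qed
qed

section \<open>Interiors of Christoffel words\<close>

text \<open>
  For \<open>0 < x < n + 2\<close> and \<open>c = 1\<close> the quotient \<open>(q * x - c) div (n + 2)\<close> is the ceiling of
  \<open>q * x / (n + 2)\<close> minus one, so \<open>c = 0\<close> and \<open>c = 1\<close> give the two kinds of Christoffel words; as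
  heights count \<open>La\<close>, the roles of the letters are exchanged: \<open>c = 0\<close> is the interior of a word
  that starts with \<open>Lb\<close> and ends with \<open>La\<close>.
\<close>

definition christoffel_height :: "int \<Rightarrow> nat \<Rightarrow> int \<Rightarrow> nat \<Rightarrow> int" where
  "christoffel_height c n q x = (q * int x - c) div (int n + 2)"

text \<open>Letter \<open>i\<close> records the increment from \<open>i + 1\<close> to
  \<open>i + 2\<close>: the first and the last letter of the Christoffel word are cut off.\<close>

definition christoffel_interior :: "int \<Rightarrow> nat \<Rightarrow> int \<Rightarrow> word" where
  "christoffel_interior c n q = map (\<lambda>i.
     if christoffel_height c n q (i + 2) = christoffel_height c n q (i + 1) then Lb else La) [0..<n]"

lemma length_christoffel_interior [simp]: "length (christoffel_interior c n q) = n"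
  by (simp add: christoffel_interior_def)

lemma div_bounds:
  fixes a N :: int
  assumes "N > 0"
  shows "N * (a div N) \<le> a" "a < N * (a div N) + N"
  using mult_div_mod_eq[of N a] pos_mod_sign[OF assms, of a] pos_mod_bound[OF assms, of a]
  by linarith+

text \<open>The difference is the quotient by \<open>N\<close> of the sum of two remainders and
  \<open>c\<close>, which lies between 0 and \<open>2 * N - 1\<close>.\<close>

lemma div_add_cases:
  fixes a b c N :: int
  assumes "N > 0" "c \<in> {0, 1}"
  shows "(a + b - c) div N - (a - c) div N - (b - c) div N \<in> {0, 1}"
proof -
  define A B S where "A = (a - c) div N" and "B = (b - c) div N" and "S = (a + b - c) div N"
  have A: "N * A \<le> a - c" "a - c < N * A + N"
    using div_bounds[OF assms(1)] by (simp_all add: A_def)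
  have B: "N * B \<le> b - c" "b - c < N * B + N"
    using div_bounds[OF assms(1)] by (simp_all add: B_def)
  have S: "N * S \<le> a + b - c" "a + b - c < N * S + N"
    using div_bounds[OF assms(1)] by (simp_all add: S_def)
  have "N * (A + B) < N * (S + 1)" "N * S < N * (A + B + 2)"
    using A B S assms(2) by (auto simp: algebra_simps)
  then have "A + B < S + 1" "S < A + B + 2"
    using assms(1) by (simp_all add: mult_less_cancel_left)
  then show ?thesis unfolding A_def[symmetric] B_def[symmetric] S_def[symmetric] by auto
qed

lemma christoffel_height_add:
  "c \<in> {0, 1} \<Longrightarrow> christoffel_height c n q (x + y) - christoffel_height c n q x
     - christoffel_height c n q y \<in> {0, 1}"
  using div_add_cases[of "int n + 2" c "q * int x" "q * int y"]
  by (simp add: christoffel_height_def algebra_simps)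

lemma christoffel_height_shift:
  "christoffel_height c n q (x + (n + 2)) = christoffel_height c n q x + q"
proof -
  have "q * int (x + (n + 2)) - c = (q * int x - c) + q * (int n + 2)"
    by (simp add: algebra_simps)
  then show ?thesis unfolding christoffel_height_def
    by (simp only: div_mult_self1)
qed

lemma christoffel_height_1:
  "c \<in> {0, 1} \<Longrightarrow> q \<in> {1..int n + 1} \<Longrightarrow> christoffel_height c n q (Suc 0) = 0"
  by (auto simp: christoffel_height_def)

lemma christoffel_height_last:
  assumes "c \<in> {0, 1}" "q \<in> {1..int n + 1}"
  shows "christoffel_height c n q (Suc n) = q - 1"
proof -
  have "q * int (Suc n) - c = (q - 1) * (int n + 2) + (int n + 2 - q - c)"
    by (simp add: algebra_simps)
  moreover have "(int n + 2 - q - c) div (int n + 2) = 0" using assms by auto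
  ultimately show ?thesis unfolding christoffel_height_def
    by (simp only: div_mult_self3)
qed

lemma height_christoffel_interior:
  assumes "c \<in> {0, 1}" "q \<in> {1..int n + 1}" "i \<le> n"
  shows "height (christoffel_interior c n q) i = christoffel_height c n q (Suc i)"
  using assms(3)
proof (induction i)
  case 0
  then show ?case using christoffel_height_1 assms by simp
next
  case (Suc i)
  have "christoffel_height c n q (Suc i + 1) - christoffel_height c n q (Suc i) \<in> {0, 1}"
    using christoffel_height_add[OF assms(1), of n q "Suc i" 1] christoffel_height_1[OF assms(1,2)]
    by simp
  then show ?case
    using Suc by (subst height_Suc) (auto simp: christoffel_interior_def)
qed

lemma bispecial_christoffel_interior:
  assumes c: "c \<in> {0, 1}" and q: "q \<in> {1..int n + 1}"
  shows "bispecial (christoffel_interior c n q)"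
  unfolding bispecial_def
proof
  let ?w = "christoffel_interior c n q" and ?g = "christoffel_height c n q"
  note h = height_christoffel_interior[OF c q]
  show "left_special ?w"
    unfolding left_special_iff_height
  proof (intro allI impI)
    fix i k assume "i + Suc k \<le> length ?w"
    then show "height ?w (i + Suc k) - height ?w i - height ?w k \<in> {0, 1}"
      using christoffel_height_add[OF c, of n q "Suc i" "Suc k"] by (simp add: h)
  qed
  show "right_special ?w"
    unfolding right_special_iff_height[OF length_christoffel_interior]
  proof (intro allI impI)
    fix i k assume ik: "i + Suc k \<le> n"
    \<comment> \<open>Right specialness is the additivity of the height at two arguments whose sum
      exceeds the period \<open>n + 2\<close>.\<close>
    have "Suc (i + Suc k) + Suc (n - k) = Suc i + (n + 2)" using ik by simp
    then have "?g (Suc i) + q - ?g (Suc (i + Suc k)) - ?g (Suc (n - k)) \<in> {0, 1}"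
      using christoffel_height_add[OF c, of n q "Suc (i + Suc k)" "Suc (n - k)"]
      by (simp only: christoffel_height_shift)
    then show "height ?w (i + Suc k) - height ?w i + height ?w (n - k) - height ?w n \<in> {0, 1}"
      using ik by (auto simp: h christoffel_height_last[OF c q])
  qed
qed

lemma bispecial_imp_christoffel_interior:
  assumes b: "bispecial w" and n: "length w = n"
  obtains c q where "c \<in> {0, 1}" "q \<in> {1..int n + 1}" "w = christoffel_interior c n q"
proof -
  define N where "N = n + 2"
  define q where "q = height w n + 1"
  define g where "g x = height w (x - 1)" for x
  have add: "g (x + y) - g x - g y \<in> {0, 1}" if xy: "x > 0" "y > 0" "x + y < N" for x y
  proof -
    obtain i k where "x = Suc i" "y = Suc k" using xy(1,2) by (metis gr0_implies_Suc)
    then show ?thesis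
      using b xy(3) unfolding bispecial_def left_special_iff_height by (simp add: g_def N_def n)
  qed
  have wrap: "g (x + y - N) + q - g x - g y \<in> {0, 1}" if "x < N" "y < N" "N < x + y" for x y
  proof -
    \<comment> \<open>The strict inequality \<open>N < x + y\<close> keeps \<open>i\<close> from
      being truncated. The case \<open>x + y = N\<close> is covered by neither kind of specialness;
      the defect below measures it.\<close>
    define i k where "i = x + y - N - 1" and "k = N - y - 1"
    have ik: "i + Suc k \<le> n" "x = Suc (i + Suc k)" "y = Suc (n - k)" "x + y - N = Suc i"
      using that by (auto simp: i_def k_def N_def)
    have "height w (i + Suc k) - height w i + height w (n - k) - height w n \<in> {0, 1}"
      using b ik(1) unfolding bispecial_def right_special_iff_height[OF n] by blast
    moreover have "g (x + y - N) = height w i" "g x = height w (i + Suc k)" "g y = height w (n - k)"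
      unfolding ik(4) by (simp_all add: g_def ik(2,3))
    ultimately show ?thesis by (auto simp: q_def)
  qed
  define defect where "defect x = g x + g (N - x) - height w n" for x
  have defect_close: "\<bar>defect x - defect y\<bar> \<le> 1" if "0 < x" "x < y" "y < N" for x y
  proof -
    have e: "x + (y - x) = y" "(N - y) + (y - x) = N - x" using that by simp_all
    \<comment> \<open>The defects at \<open>x\<close> and \<open>y\<close> differ by the difference
      of two additivity errors with the same summand \<open>g (y - x)\<close>.\<close>
    have "g y - g x - g (y - x) \<in> {0, 1}" "g (N - x) - g (N - y) - g (y - x) \<in> {0, 1}"
      using add[of x "y - x"] add[of "N - y" "y - x"] that unfolding e by simp_all
    then show ?thesis by (auto simp: defect_def)
  qed
  have defect_1: "defect 1 = 0" by (simp add: defect_def g_def N_def)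
  have defect_range: "defect x \<in> {-1, 0, 1}" if "0 < x" "x < N" for x
    using defect_close[of 1 x] defect_1 that by (cases "x = 1") auto
  have "(\<forall>x. 0 < x \<longrightarrow> x < N \<longrightarrow> defect x \<in> {0, 1}) \<or> (\<forall>x. 0 < x \<longrightarrow> x < N \<longrightarrow> defect x \<in> {-1, 0})"
  proof (rule ccontr)
    assume "\<not> ?thesis"
    then obtain x y where xy: "0 < x" "x < N" "defect x \<notin> {0, 1}" "0 < y" "y < N" "defect y \<notin> {-1, 0}"
      by blast
    then have "defect x = -1" "defect y = 1" using defect_range by blast+
    moreover from this have "x \<noteq> y" by auto
    ultimately show False
      using defect_close[of x y] defect_close[of y x] xy by (cases "x < y") auto
  qed
  then have "\<exists>c\<in>{0, 1}. \<forall>x. 0 < x \<longrightarrow> x < N \<longrightarrow> g x = (q * int x - c) div int N"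
  proof
    assume d: "\<forall>x. 0 < x \<longrightarrow> x < N \<longrightarrow> defect x \<in> {0, 1}"
    define f where "f x = (if x = 0 then 0 else g x)" for x
    have "f x = q * int x div int N" if "x < N" for x
    proof (rule floor_of_quasi_additive[OF _ _ _ that])
      show "f 0 = 0" by (simp add: f_def)
      show "f (x + y) - f x - f y \<in> {0, 1}" if "x + y < N" for x y
        using add[of x y] that by (auto simp: f_def)
      show "f (x + y - N) + q - f x - f y \<in> {0, 1}" if xy: "x < N" "y < N" "N \<le> x + y" for x y
      proof (cases "x + y = N")
        case True
        then have "y = N - x" "0 < x" using xy by simp_all
        then have "g x + g y - height w n \<in> {0, 1}" using d xy by (auto simp: defect_def)
        then show ?thesis using True xy by (auto simp: f_def q_def)
      next
        case False
        then show ?thesis using wrap[of x y] xy by (auto simp: f_def)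
      qed
    qed
    then have "\<forall>x. 0 < x \<longrightarrow> x < N \<longrightarrow> g x = (q * int x - 0) div int N"
      by (metis diff_zero f_def less_irrefl)
    then show ?thesis by blast
  next
    assume d: "\<forall>x. 0 < x \<longrightarrow> x < N \<longrightarrow> defect x \<in> {-1, 0}"
    \<comment> \<open>Negation turns the ceiling into a floor of slope \<open>- q\<close>, and the
      shift by one brings the errors back from \<open>{-1, 0}\<close> to
      \<open>{0, 1}\<close>.\<close>
    define f where "f x = (if x = 0 then 0 else - g x - 1)" for x
    have f: "f x = - q * int x div int N" if "x < N" for x
    proof (rule floor_of_quasi_additive[OF _ _ _ that])
      show "f 0 = 0" by (simp add: f_def)
      show "f (x + y) - f x - f y \<in> {0, 1}" if "x + y < N" for x y
        using add[of x y] that by (auto simp: f_def)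
      show "f (x + y - N) + - q - f x - f y \<in> {0, 1}" if xy: "x < N" "y < N" "N \<le> x + y" for x y
      proof (cases "x + y = N")
        case True
        then have "y = N - x" "0 < x" using xy by simp_all
        then have "g x + g y - height w n \<in> {-1, 0}" using d xy by (auto simp: defect_def)
        then show ?thesis using True xy by (auto simp: f_def q_def)
      next
        case False
        then show ?thesis using wrap[of x y] xy by (auto simp: f_def)
      qed
    qed
    have "g x = (q * int x - 1) div int N" if "0 < x" "x < N" for x
    proof -
      have N: "int N > 0" by (simp add: N_def)
      have "- q * int x div int N = - g x - 1" using f[of x] that by (simp add: f_def)
      with div_bounds[OF N, of "- q * int x"]
      have "int N * (- g x - 1) \<le> - q * int x" "- q * int x < int N * (- g x - 1) + int N"
        by metis+
      then have "int N * g x \<le> q * int x - 1" "q * int x - 1 < int N * g x + int N"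
        by (simp_all add: algebra_simps)
      then show ?thesis
        by (intro int_div_pos_eq[where r = "q * int x - 1 - int N * g x", symmetric]) simp_all
    qed
    then show ?thesis by blast
  qed
  then obtain c where c: "c \<in> {0, 1}"
    and g: "\<And>x. 0 < x \<Longrightarrow> x < N \<Longrightarrow> g x = (q * int x - c) div int N" by blast
  have "count_list w La \<le> length w" by (rule count_le_length)
  then have q: "q \<in> {1..int n + 1}" by (auto simp: q_def height_def n)
  have "w = christoffel_interior c n q"
  proof (rule word_eqI_height)
    fix i assume "i \<le> length w"
    then show "height w i = height (christoffel_interior c n q) i"
      using height_christoffel_interior[OF c q, of i] g[of "Suc i"] n
      by (simp add: g_def N_def christoffel_height_def algebra_simps)
  qed (simp add: n)
  with c q show ?thesis by (rule that)
qed

section \<open>Counting\<close>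

text \<open>The number of letters \<open>La\<close> in the interior is \<open>q - 1\<close> for
  either kind. With \<open>c = d\<close> this gives injectivity, with distinct kinds it controls the
  intersection.\<close>

lemma christoffel_interior_inj:
  assumes "c \<in> {0, 1}" "d \<in> {0, 1}" "q \<in> {1..int n + 1}" "r \<in> {1..int n + 1}"
    and eq: "christoffel_interior c n q = christoffel_interior d n r"
  shows "q = r"
  using height_christoffel_interior[OF assms(1,3), of n] height_christoffel_interior[OF assms(2,4), of n]
    christoffel_height_last[OF assms(1,3)] christoffel_height_last[OF assms(2,4)] eq by simp

lemma div_diff_one_eq_iff:
  fixes a N :: int
  assumes "N > 0"
  shows "(a - 1) div N = a div N \<longleftrightarrow> \<not> N dvd a"
proof (cases "N dvd a")
  case True
  then obtain k where "a = N * k" by blast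
  moreover have "(N * k - 1) div N = k - 1"
    using assms by (intro int_div_pos_eq[where r = "N - 1"]) (auto simp: algebra_simps)
  ultimately show ?thesis using assms by simp
next
  case False
  have "a mod N \<noteq> 0" using False by (simp add: dvd_eq_mod_eq_0)
  then have "0 \<le> a mod N - 1" "a mod N - 1 < N"
    using assms pos_mod_sign[of N a] pos_mod_bound[of N a] by linarith+
  then have "(a - 1) div N = a div N"
    by (intro int_div_pos_eq[where r = "a mod N - 1"]) (simp_all add: mult_div_mod_eq)
  with False show ?thesis by simp
qed

text \<open>The two heights differ at \<open>x\<close> exactly if \<open>n + 2\<close> divides
  \<open>q * x\<close>. Some \<open>x\<close> strictly between 0 and \<open>n + 2\<close> has this
  property exactly if \<open>q\<close> and \<open>n + 2\<close> share a factor.\<close>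

lemma christoffel_interior_eq_iff_coprime:
  assumes q: "q \<in> {1..int n + 1}"
  shows "christoffel_interior 0 n q = christoffel_interior 1 n q \<longleftrightarrow> coprime q (int n + 2)"
proof -
  let ?N = "int n + 2"
  have "christoffel_interior 0 n q = christoffel_interior 1 n q \<longleftrightarrow>
    (\<forall>i\<le>n. christoffel_height 0 n q (Suc i) = christoffel_height 1 n q (Suc i))"
    (is "?A \<longleftrightarrow> ?B")
  proof -
    have h: "height (christoffel_interior c n q) i = christoffel_height c n q (Suc i)"
      if "i \<le> n" "c \<in> {0, 1}" for c i
      using height_christoffel_interior q that by blast
    have "?A \<longleftrightarrow> (\<forall>i\<le>n. height (christoffel_interior 0 n q) i = height (christoffel_interior 1 n q) i)"
      by (auto intro!: word_eqI_height)
    then show ?thesis using h by simp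
  qed
  also have "\<dots> \<longleftrightarrow> (\<forall>i\<le>n. \<not> ?N dvd q * int (Suc i))"
  proof -
    have "christoffel_height 0 n q x = christoffel_height 1 n q x \<longleftrightarrow> \<not> ?N dvd q * int x" for x
      using div_diff_one_eq_iff[of ?N "q * int x"]
      by (auto simp: christoffel_height_def)
    then show ?thesis by blast
  qed
  also have "\<dots> \<longleftrightarrow> coprime q ?N"
  proof
    assume "coprime q ?N"
    then have "\<not> ?N dvd q * int (Suc i)" if "i \<le> n" for i
      using that zdvd_not_zless[of "int (Suc i)" ?N]
      by (simp add: coprime_dvd_mult_right_iff coprime_commute)
    then show "\<forall>i\<le>n. \<not> ?N dvd q * int (Suc i)" by blast
  next
    assume nd: "\<forall>i\<le>n. \<not> ?N dvd q * int (Suc i)"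
    show "coprime q ?N"
    proof (rule ccontr)
      assume nc: "\<not> coprime q ?N"
      define d where "d = gcd q ?N"
      have d0: "d > 0" by (simp add: d_def)
      moreover have "d \<noteq> 1" using nc by (simp add: d_def coprime_iff_gcd_eq_1)
      ultimately have d: "d \<ge> 2" by linarith
      obtain u where u: "q = d * u" using gcd_dvd1[of q ?N] unfolding d_def by blast
      \<comment> \<open>The witness is \<open>n + 2\<close> divided by the gcd; it is below
        \<open>n + 2\<close> because the gcd is at least 2.\<close>
      obtain x where x: "?N = d * x" using gcd_dvd2[of q ?N] unfolding d_def by blast
      have x0: "x > 0" using x d0 zero_less_mult_pos[of d x] by simp
      moreover have "2 * x \<le> d * x" using d x0 by (intro mult_right_mono) simp_all
      then have "x < ?N" using x x0 by linarith
      ultimately have "nat x - 1 \<le> n" "int (Suc (nat x - 1)) = x" by linarith+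
      moreover have "q * x = ?N * u" by (simp add: u x)
      ultimately show False using nd by (metis dvd_triv_left)
    qed
  qed
  finally show ?thesis .
qed

text \<open>As \<open>n + 2\<close> exceeds 1, it is not coprime to itself, so the totatives stop at
  \<open>n + 1\<close>.\<close>

lemma card_coprime_eq_totient:
  "card {q \<in> {1..int n + 1}. coprime q (int n + 2)} = totient (n + 2)"
proof -
  have "{q \<in> {1..int n + 1}. coprime q (int n + 2)} = int ` totatives (n + 2)"
  proof (intro equalityI subsetI)
    fix q assume q: "q \<in> {q \<in> {1..int n + 1}. coprime q (int n + 2)}"
    then have "coprime (int (nat q)) (int (n + 2))" by (simp add: add.commute)
    then have "coprime (nat q) (n + 2)" by (simp only: coprime_int_iff)
    then have "nat q \<in> totatives (n + 2)" using q by (auto simp: totatives_def)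
    then show "q \<in> int ` totatives (n + 2)" using q by (intro image_eqI[of _ _ "nat q"]) auto
  next
    fix q assume "q \<in> int ` totatives (n + 2)"
    then obtain k where k: "q = int k" "k \<in> totatives (n + 2)" by blast
    have N: "int n + 2 = int (n + 2)" by simp
    have "coprime (int k) (int n + 2)"
      unfolding N coprime_int_iff using k by (simp add: totatives_def)
    moreover have "0 < k" "k < n + 2"
      using k totatives_less[of k "n + 2"] by (simp_all add: totatives_def)
    ultimately show "q \<in> {q \<in> {1..int n + 1}. coprime q (int n + 2)}" using k by simp
  qed
  then show ?thesis by (simp add: totient_def card_image)
qed

theorem corollary4p2:
  fixes n :: nat
  shows "int (card {w. bispecial w \<and> length w = n}) = 2 * (int n + 1) - int (totient (n + 2))"
proof -
  let ?Q = "{1..int n + 1}"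
  let ?L = "christoffel_interior 0 n ` ?Q" and ?U = "christoffel_interior 1 n ` ?Q"
  let ?C = "{q \<in> ?Q. coprime q (int n + 2)}"
  have set_eq: "{w. bispecial w \<and> length w = n} = ?L \<union> ?U"
  proof (intro equalityI subsetI)
    fix w assume "w \<in> {w. bispecial w \<and> length w = n}"
    then obtain c q where "c \<in> {0, 1}" "q \<in> ?Q" "w = christoffel_interior c n q"
      using bispecial_imp_christoffel_interior by blast
    then show "w \<in> ?L \<union> ?U" by blast
  next
    fix w assume "w \<in> ?L \<union> ?U"
    then obtain c q where "c \<in> {0, 1}" "q \<in> ?Q" "w = christoffel_interior c n q" by blast
    then show "w \<in> {w. bispecial w \<and> length w = n}"
      using bispecial_christoffel_interior by simp
  qed
  have inj: "inj_on (christoffel_interior c n) ?Q" if "c \<in> {0, 1}" for c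
    using christoffel_interior_inj[OF that that] by (rule inj_onI)
  have card_L: "card ?L = n + 1" and card_U: "card ?U = n + 1"
    by (subst card_image[OF inj]; simp)+
  have Int_eq: "?L \<inter> ?U = christoffel_interior 0 n ` ?C"
  proof (intro equalityI subsetI)
    fix w assume "w \<in> ?L \<inter> ?U"
    then obtain q r where qr: "q \<in> ?Q" "r \<in> ?Q" "w = christoffel_interior 0 n q"
      "christoffel_interior 0 n q = christoffel_interior 1 n r" by blast
    then have "q = r" by (intro christoffel_interior_inj[of 0 1 q n r]) simp_all
    with qr christoffel_interior_eq_iff_coprime show "w \<in> christoffel_interior 0 n ` ?C" by blast
  next
    fix w assume "w \<in> christoffel_interior 0 n ` ?C"
    then show "w \<in> ?L \<inter> ?U" using christoffel_interior_eq_iff_coprime by blast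
  qed
  have "inj_on (christoffel_interior 0 n) ?C" by (rule inj_on_subset[OF inj]) auto
  then have "card (?L \<inter> ?U) = totient (n + 2)"
    unfolding Int_eq card_coprime_eq_totient[symmetric] by (rule card_image)
  \<comment> \<open>Inclusion-exclusion: the words counted twice correspond to the \<open>q\<close>
    coprime to \<open>n + 2\<close>.\<close>
  moreover have "card ?L + card ?U = card (?L \<union> ?U) + card (?L \<inter> ?U)"
    by (intro card_Un_Int finite_imageI) simp_all
  ultimately have "card (?L \<union> ?U) + totient (n + 2) = 2 * (n + 1)"
    by (metis card_L card_U mult_2)
  then have "int (card (?L \<union> ?U)) + int (totient (n + 2)) = int (2 * (n + 1))"
    by (simp only: of_nat_add[symmetric])
  then show ?thesis unfolding set_eq by simp
qed

end
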